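(* Let $n=p_1^{n_1}p_2^{n_2}$, where $p_1,p_2$ are distinct primes and $n_1,n_2\geq 1$ are integers. Let $G(\mathbb{Z}_n)=(V,E)$ be the unit graph of $\mathbb{Z}_n$ and let $H$ be a $|V|\times|E|$ incidence matrix of $G(\mathbb{Z}_n)$. (1) If $2$ is a unit in $\mathbb{Z}_n$, then the binary code $C_2(H)$ generated by $H$ is a $\left[\frac{(n-1)\phi(n)}{2},\,n-1,\,\phi(n)-1\right]_{2}$ code over $\mathbb{F}_2$. (2) If $2$ is a non-unit in $\mathbb{Z}_n$, then for any odd prime $q$ the $q$-ary code $C_q(H)$ generated by $H$ is a $\left[\frac{n\phi(n)}{2},\,n-1,\,\phi(n)\right]_{q}$ code over $\mathbb{F}_q$.
   Context: The unit graph $G(\mathbb{Z}_n)$ is the simple graph with vertex set $\mathbb{Z}_n$ in which two distinct vertices $x,y$ are adjacent iff $x+y$ is a unit of $\mathbb{Z}_n$. An incidence matrix of a graph has rows indexed by vertices and columns by edges, with entry $1$ if the vertex is an endpoint of the edge and $0$ otherwise. For a prime $q$, $C_q(H)$ denotes the $\mathbb{F}_q$-span of the rows of $H$ (entries read in $\mathbb{F}_q$), a subspace of $\mathbb{F}_q^{|E|}$. An $[N,k,d]_q$ code is a linear subspace of $\mathbb{F}_q^N$ of dimension $k$ whose minimum Hamming weight of nonzero vectors (equivalently, minimum distance) is $d$. $\phi$ is Euler's totient function. *)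

theory Defs
  imports
    "HOL-Number_Theory.Residues"
    "HOL-Number_Theory.Totient"
    "Jordan_Normal_Form.VS_Connect"
    "Berlekamp_Zassenhaus.Finite_Field"
begin

text \<open>Edges are represented as two-element sets of vertices.\<close>

definition unit_graph :: "('a, 'b) ring_scheme \<Rightarrow> 'a set \<times> 'a set set" where
  "unit_graph R =
     (carrier R,
      {{x, y} | x y. x \<in> carrier R \<and> y \<in> carrier R \<and> x \<noteq> y \<and> x \<oplus>\<^bsub>R\<^esub> y \<in> Units R})"

text \<open>
  An incidence matrix depends on the order in which vertices and edges are listed; the
  predicate below holds of the incidence matrices for all possible orderings. The entries are
  integers, so that one and the same matrix can be read over every field.
\<close>

definition is_incidence_matrix :: "int mat \<Rightarrow> 'v set \<times> 'v set set \<Rightarrow> bool" where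
  "is_incidence_matrix H G \<longleftrightarrow>
     (\<exists>vs es. distinct vs \<and> set vs = fst G \<and> distinct es \<and> set es = snd G \<and>
        H = mat (length vs) (length es) (\<lambda>(i, j). if vs ! i \<in> es ! j then 1 else 0))"

text \<open>
  The field $F_q$ is the type \<^typ>\<open>'q mod_ring\<close> of residues modulo \<open>q = CARD('q)\<close>; in particular
  $F_2$ is \<^typ>\<open>bool mod_ring\<close>.
\<close>

definition code_of :: "int mat \<Rightarrow> 'q :: prime_card mod_ring vec set" where
  "code_of H = vec_space.row_space (dim_col H) (map_mat of_int H)"

definition hamming_weight :: "'a :: zero vec \<Rightarrow> nat" where
  "hamming_weight v = card {i. i < dim_vec v \<and> v $ i \<noteq> 0}"

text \<open>\<open>linear_code N k d q C\<close> says that \<open>C\<close> is an $[N,k,d]_q$ code.\<close>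

definition linear_code ::
    "nat \<Rightarrow> nat \<Rightarrow> nat \<Rightarrow> nat \<Rightarrow> 'f :: {field, finite} vec set \<Rightarrow> bool" where
  "linear_code N k d q C \<longleftrightarrow>
     CARD('f) = q \<and>
     VectorSpace.subspace class_ring C (module_vec TYPE('f) N) \<and>
     vectorspace.dim class_ring ((module_vec TYPE('f) N)\<lparr>carrier := C\<rparr>) = k \<and>
     (\<exists>v \<in> C. v \<noteq> 0\<^sub>v N \<and> hamming_weight v = d) \<and>
     (\<forall>v \<in> C. v \<noteq> 0\<^sub>v N \<longrightarrow> d \<le> hamming_weight v)"

end

theory Submission
  imports Defs
begin

text \<open>
  The codeword with coefficients \<open>c\<close> has entry \<open>c x + c y\<close> at the edge \<open>{x, y}\<close>. If \<open>\<epsilon>\<close> is a nowhere zero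
  function on the vertices with \<open>\<epsilon> x + \<epsilon> y = 0\<close> on edges (constant in characteristic 2, alternating
  on a bipartite graph), then that entry vanishes iff \<open>c / \<epsilon>\<close> agrees at \<open>x\<close> and \<open>y\<close>. Hence the support
  of a codeword contains the edge cut of every level set of \<open>c / \<epsilon>\<close>: on a connected graph the only
  linear relation between the rows is \<open>\<epsilon>\<close>, and the minimum distance is at least the edge connectivity.
  A single row attains the minimum degree, and the two agree because the unit graph has diameter at
  most 2 for odd \<open>n\<close>, and for even \<open>n\<close> it is bipartite with a common neighbour for any two vertices in
  the same part.
\<close>

section \<open>Edge cuts and minimum degree\<close>

locale simple_graph =
  fixes V :: "'v set" and E :: "'v set set"
  assumes finite_vertices: "finite V"
    and edge_ends: "e \<in> E \<Longrightarrow> \<exists>x\<in>V. \<exists>y\<in>V. x \<noteq> y \<and> e = {x, y}"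
begin

definition nbrs :: "'v \<Rightarrow> 'v set" where
  "nbrs x = {y. {x, y} \<in> E}"

definition cut :: "'v set \<Rightarrow> 'v set set" where
  "cut S = {e \<in> E. e \<inter> S \<noteq> {} \<and> e - S \<noteq> {}}"

lemma edge_subset: "e \<in> E \<Longrightarrow> e \<subseteq> V"
  using edge_ends by blast

lemma finite_edges: "finite E"
  using finite_vertices edge_subset by (intro finite_subset[of E "Pow V"]) auto

lemma edge_distinct: "{x, y} \<in> E \<Longrightarrow> x \<noteq> y"
  using edge_ends by (metis doubleton_eq_iff)

lemma nbrs_subset: "nbrs x \<subseteq> V - {x}"
  using edge_subset edge_distinct unfolding nbrs_def by blast

lemma finite_nbrs: "finite (nbrs x)"
  using nbrs_subset finite_vertices by (meson finite_Diff finite_subset)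

lemma card_incident: "card {e \<in> E. x \<in> e} = card (nbrs x)"
proof -
  have "bij_betw (\<lambda>y. {x, y}) (nbrs x) {e \<in> E. x \<in> e}"
    unfolding bij_betw_def
  proof
    show "inj_on (\<lambda>y. {x, y}) (nbrs x)"
      by (auto simp: inj_on_def doubleton_eq_iff)
    show "(\<lambda>y. {x, y}) ` nbrs x = {e \<in> E. x \<in> e}"
      using edge_ends unfolding nbrs_def by (auto simp: image_iff) (metis insert_commute insertE singletonD)
  qed
  then show ?thesis
    using bij_betw_same_card by fastforce
qed

lemma handshake: "(\<Sum>x\<in>V. card (nbrs x)) = 2 * card E"
proof -
  have "card {x \<in> V. x \<in> e} = 2" if e: "e \<in> E" for e
  proof -
    obtain x y where "x \<in> V" "y \<in> V" "x \<noteq> y" "e = {x, y}"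
      using edge_ends[OF e] by blast
    moreover from this have "{x \<in> V. x \<in> e} = {x, y}"
      by auto
    ultimately show ?thesis
      by simp
  qed
  then have "(\<Sum>x\<in>V. card {e \<in> E. x \<in> e}) = 2 * card E"
    using finite_vertices finite_edges by (intro sum_multicount) auto
  then show ?thesis
    by (simp add: card_incident)
qed

section \<open>Lower bounds on the size of an edge cut\<close>

lemma cut_Compl: "cut (V - S) = cut S"
  using edge_subset unfolding cut_def by blast

text \<open>A cut edge has exactly one end in \<open>S\<close>, so it can be oriented out of
  \<open>S\<close> in one way only; this turns the cut into a disjoint union over its inner
  ends.\<close>

lemma card_cut:
  assumes "S \<subseteq> V"
  shows "card (cut S) = (\<Sum>s\<in>S. card (nbrs s - S))"
proof -
  have "bij_betw (\<lambda>(s, t). {s, t}) (SIGMA s:S. nbrs s - S) (cut S)"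
    unfolding bij_betw_def
  proof
    show "inj_on (\<lambda>(s, t). {s, t}) (SIGMA s:S. nbrs s - S)"
      by (auto simp: inj_on_def doubleton_eq_iff)
    have "e \<in> (\<lambda>(s, t). {s, t}) ` (SIGMA s:S. nbrs s - S)" if "e \<in> cut S" for e
    proof -
      have e: "e \<in> E" "e \<inter> S \<noteq> {}" "e - S \<noteq> {}"
        using that by (simp_all add: cut_def)
      obtain x y where "e = {x, y}"
        using edge_ends[OF e(1)] by blast
      then obtain s t where st: "e = {s, t}" "s \<in> S" "t \<notin> S"
        using e(2,3) by (cases "x \<in> S") (auto simp: insert_commute)
      note e(1)
      moreover note st
      ultimately have "(s, t) \<in> (SIGMA s:S. nbrs s - S)"
        by (simp add: nbrs_def)
      then show ?thesis
        using st(1) by (metis (mono_tags, lifting) case_prod_conv image_eqI)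
    qed
    then show "(\<lambda>(s, t). {s, t}) ` (SIGMA s:S. nbrs s - S) = cut S"
      by (auto simp: cut_def nbrs_def)
  qed
  then have "card (cut S) = card (SIGMA s:S. nbrs s - S)"
    using bij_betw_same_card by fastforce
  also have "\<dots> = (\<Sum>s\<in>S. card (nbrs s - S))"
    using assms finite_vertices finite_nbrs by (intro card_SigmaI) (auto intro: finite_subset)
  finally show ?thesis .
qed

text \<open>Every vertex of \<open>T\<close> sends at least one edge out of \<open>S\<close>, hence
  adds at least 1 to the sum in \<open>card_cut\<close>. The subset \<open>T\<close> is kept apart
  from \<open>S\<close> because both \<open>T = S\<close> and a neighbourhood inside
  \<open>S\<close> are needed later.\<close>

lemma cut_ge_card:
  assumes "S \<subseteq> V" "T \<subseteq> S" and "\<And>s. s \<in> T \<Longrightarrow> \<not> nbrs s \<subseteq> S"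
  shows "card T \<le> card (cut S)"
proof -
  have fin: "finite S"
    using assms(1) finite_vertices by (rule finite_subset)
  have "1 \<le> card (nbrs s - S)" if "s \<in> T" for s
    using assms(3)[OF that] finite_nbrs[of s]
    by (metis Diff_eq_empty_iff One_nat_def Suc_leI card_gt_0_iff finite_Diff)
  then have "card T * 1 \<le> (\<Sum>s\<in>T. card (nbrs s - S))"
    by (metis sum_bounded_below of_nat_id)
  also have "\<dots> \<le> (\<Sum>s\<in>S. card (nbrs s - S))"
    using fin assms(2) by (intro sum_mono2) auto
  finally show ?thesis
    using card_cut[OF assms(1)] by simp
qed

text \<open>A vertex of \<open>S\<close> has at most \<open>card S - 1\<close> neighbours inside
  \<open>S\<close>, so at least \<open>d + 1 - card S\<close> of its edges leave
  \<open>S\<close>.\<close>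

lemma cut_ge_small:
  assumes "S \<subseteq> V" "S \<noteq> {}" "card S \<le> d" and "\<And>x. x \<in> V \<Longrightarrow> d \<le> card (nbrs x)"
  shows "d \<le> card (cut S)"
proof -
  have fin: "finite S"
    using assms(1) finite_vertices by (rule finite_subset)
  then have S0: "0 < card S"
    using assms(2) by (simp add: card_gt_0_iff)
  have "d + 1 - card S \<le> card (nbrs s - S)" if "s \<in> S" for s
  proof -
    have "card (nbrs s) \<le> card ((nbrs s - S) \<union> (S - {s}))"
      using nbrs_subset[of s] fin finite_nbrs[of s] by (intro card_mono) auto
    also have "\<dots> \<le> card (nbrs s - S) + card (S - {s})"
      by (rule card_Un_le)
    also have "card (S - {s}) = card S - 1"
      using that fin by simp
    finally show ?thesis
      using assms(4)[of s] assms(1) that S0 by auto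
  qed
  then have "card S * (d + 1 - card S) \<le> card (cut S)"
    unfolding card_cut[OF assms(1)] by (metis sum_bounded_below of_nat_id)
  \<comment> \<open>With \<open>card S = a + 1\<close> and \<open>d = a + 1 + b\<close> the product
    is (a + 1)(b + 1) = ab + d.\<close>
  moreover have "d \<le> card S * (d + 1 - card S)"
  proof -
    obtain a b where "card S = Suc a" "d = Suc a + b"
      using S0 assms(3) by (metis gr0_implies_Suc le_iff_add)
    then show ?thesis
      by simp
  qed
  ultimately show ?thesis
    by simp
qed

text \<open>The first alternative of \<open>near\<close> is the diameter 2 situation; the second
  serves bipartite graphs, where non-adjacent vertices of opposite parts have no common neighbour.
  If every vertex on one side of the cut has a neighbour across, counting on that side suffices.
  Otherwise each side has a vertex whose neighbours all stay on its side, and \<open>near\<close> is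
  applied to these two vertices.\<close>

lemma min_degree_le_cut:
  assumes deg: "\<And>x. x \<in> V \<Longrightarrow> d \<le> card (nbrs x)"
    and near: "\<And>x y. \<lbrakk>x \<in> V; y \<in> V; x \<noteq> y; y \<notin> nbrs x\<rbrakk> \<Longrightarrow>
      nbrs x \<inter> nbrs y \<noteq> {} \<or> (\<forall>z\<in>nbrs x. nbrs z \<inter> nbrs y \<noteq> {})"
    and S: "S \<subseteq> V" "S \<noteq> {}" "S \<noteq> V"
  shows "d \<le> card (cut S)"
proof -
  \<comment> \<open>A set with more than \<open>d\<close> vertices is handled by one cut edge per
    vertex, a smaller one by \<open>cut_ge_small\<close>.\<close>
  have *: "d \<le> card (cut T)" if T: "T \<subseteq> V" "T \<noteq> {}" and out: "\<And>s. s \<in> T \<Longrightarrow> \<not> nbrs s \<subseteq> T" for T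
    using cut_ge_card[OF T(1) order_refl out] cut_ge_small[OF T _ deg] by linarith
  show ?thesis
  proof (cases "\<exists>x\<in>S. nbrs x \<subseteq> S")
    case False
    then show ?thesis
      using * S(1,2) by blast
  next
    case True
    then obtain x where x: "x \<in> S" "nbrs x \<subseteq> S"
      by blast
    show ?thesis
    proof (cases "\<exists>y\<in>V - S. nbrs y \<subseteq> V - S")
      case False
      then have "d \<le> card (cut (V - S))"
        using S by (intro *) auto
      then show ?thesis
        by (simp add: cut_Compl)
    next
      case True
      then obtain y where y: "y \<in> V - S" "nbrs y \<subseteq> V - S"
        by blast
      then have "nbrs x \<inter> nbrs y \<noteq> {} \<or> (\<forall>z\<in>nbrs x. nbrs z \<inter> nbrs y \<noteq> {})"
        using x S(1) by (intro near) auto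
      \<comment> \<open>The two neighbourhoods lie on different sides and are disjoint, so only the
        second alternative remains: each neighbour of \<open>x\<close> has a neighbour outside
        \<open>S\<close>.\<close>
      then have "\<not> nbrs z \<subseteq> S" if "z \<in> nbrs x" for z
        using that x y by blast
      then have "card (nbrs x) \<le> card (cut S)"
        using x S(1) by (intro cut_ge_card) auto
      then show ?thesis
        using deg[of x] x(1) S(1) by auto
    qed
  qed
qed

end

section \<open>The code spanned by an incidence matrix\<close>

text \<open>The combination of the rows of the incidence matrix with coefficients \<open>c\<close>.
  Coefficients are a function on vertices instead of a vector, so that the ordering of the vertices
  disappears.\<close>

definition codeword :: "'v set list \<Rightarrow> ('v \<Rightarrow> 'f) \<Rightarrow> 'f :: comm_monoid_add vec" where
  "codeword es c = vec (length es) (\<lambda>j. \<Sum>v\<in>es ! j. c v)"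

lemma dim_codeword [simp]: "dim_vec (codeword es c) = length es"
  by (simp add: codeword_def)

lemma codeword_carrier [simp]: "codeword es c \<in> carrier_vec (length es)"
  by (simp add: codeword_def)

lemma codeword_add: "codeword es (\<lambda>v. c v + d v) = codeword es c + codeword es d"
  by (rule eq_vecI) (simp_all add: codeword_def sum.distrib)

lemma codeword_smult: "codeword es (\<lambda>v. a * c v) = a \<cdot>\<^sub>v codeword es c"
  for a :: "'f :: comm_semiring_0"
  by (rule eq_vecI) (simp_all add: codeword_def sum_distrib_left)

lemma codeword_zero: "codeword es (\<lambda>v. 0) = 0\<^sub>v (length es)"
  by (rule eq_vecI) (simp_all add: codeword_def)

lemma codeword_eq_iff:
  "codeword es c = codeword es d \<longleftrightarrow> (\<forall>e\<in>set es. (\<Sum>v\<in>e. c v) = (\<Sum>v\<in>e. d v))"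
  by (auto simp: codeword_def vec_eq_iff all_set_conv_all_nth)

lemma hamming_weight_codeword:
  assumes "distinct es"
  shows "hamming_weight (codeword es c) = card {e \<in> set es. (\<Sum>v\<in>e. c v) \<noteq> 0}"
proof -
  let ?I = "{i. i < length es \<and> (\<Sum>v\<in>es ! i. c v) \<noteq> 0}"
  have "inj_on ((!) es) ?I"
    using assms by (auto simp: inj_on_def nth_eq_iff_index_eq)
  moreover have "(!) es ` ?I = {e \<in> set es. (\<Sum>v\<in>e. c v) \<noteq> 0}"
    by (auto simp: in_set_conv_nth)
  moreover have "{i. i < dim_vec (codeword es c) \<and> codeword es c $ i \<noteq> 0} = ?I"
    by (auto simp: codeword_def)
  ultimately show ?thesis
    unfolding hamming_weight_def using card_image[of "(!) es" ?I] by simp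
qed

text \<open>The row space is the image of the transpose, and column \<open>j\<close> of the matrix
  picks out the coefficients at the ends of edge \<open>j\<close>.\<close>

lemma code_of_incidence_matrix:
  assumes "distinct vs" and sub: "\<And>e. e \<in> set es \<Longrightarrow> e \<subseteq> set vs"
  shows "code_of (mat (length vs) (length es) (\<lambda>(i, j). if vs ! i \<in> es ! j then 1 else 0))
    = (range (codeword es) :: 'q :: prime_card mod_ring vec set)"
proof -
  let ?n = "length vs" and ?m = "length es"
  let ?H = "mat ?n ?m (\<lambda>(i, j). if vs ! i \<in> es ! j then 1 else 0) :: int mat"
  define A :: "'q mod_ring mat" where "A = map_mat of_int ?H"
  have A: "A \<in> carrier_mat ?n ?m"
    by (simp add: A_def)
  have key: "A\<^sup>T *\<^sub>v vec ?n (\<lambda>i. c (vs ! i)) = codeword es c" for c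
  proof (rule eq_vecI)
    fix j assume "j < dim_vec (codeword es c)"
    then have j: "j < ?m"
      by simp
    have "(A\<^sup>T *\<^sub>v vec ?n (\<lambda>i. c (vs ! i))) $ j = (\<Sum>i<?n. if vs ! i \<in> es ! j then c (vs ! i) else 0)"
      using j by (auto simp: A_def scalar_prod_def atLeast0LessThan intro!: sum.cong)
    also have "\<dots> = (\<Sum>v\<in>set vs. if v \<in> es ! j then c v else 0)"
      by (rule sum.reindex_bij_betw[OF bij_betw_nth[OF assms(1) refl refl]])
    also have "\<dots> = (\<Sum>v\<in>es ! j. c v)"
      using sub[OF nth_mem[OF j]] by (simp add: sum.inter_restrict[symmetric] Int_absorb1)
    finally show "(A\<^sup>T *\<^sub>v vec ?n (\<lambda>i. c (vs ! i))) $ j = codeword es c $ j"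
      using j by (simp add: codeword_def)
  qed (simp add: A_def)
  \<comment> \<open>As the listed vertices are distinct, every coefficient vector comes from a
    function on vertices.\<close>
  have "\<exists>c. y = vec ?n (\<lambda>i. c (vs ! i))" if "y \<in> carrier_vec ?n" for y :: "'q mod_ring vec"
  proof
    show "y = vec ?n (\<lambda>i. y $ inv_into {..<?n} ((!) vs) (vs ! i))"
    proof (rule eq_vecI)
      fix i assume "i < dim_vec (vec ?n (\<lambda>i. y $ inv_into {..<?n} ((!) vs) (vs ! i)))"
      then have "i < ?n"
        by simp
      moreover have "inj_on ((!) vs) {..<?n}"
        using assms(1) by (intro inj_on_nth) auto
      ultimately show "y $ i = vec ?n (\<lambda>i. y $ inv_into {..<?n} ((!) vs) (vs ! i)) $ i"
        by (simp add: inv_into_f_f)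
    qed (use that in simp)
  qed
  then have "carrier_vec ?n = range (\<lambda>c. vec ?n (\<lambda>i. c (vs ! i)) :: 'q mod_ring vec)"
    by auto
  then have "(\<lambda>y. A\<^sup>T *\<^sub>v y) ` carrier_vec ?n = range (codeword es)"
    by (simp only: image_image key)
  moreover have "vec_space.row_space ?m A = (\<lambda>y. A\<^sup>T *\<^sub>v y) ` carrier_vec ?n"
    unfolding vec_space.row_space_eq[OF A] carrier_matD[OF A]
    using A by (auto intro!: mult_mat_vec_carrier)
  ultimately show ?thesis
    by (simp add: code_of_def A_def)
qed

lemma subspace_codewords:
  "VectorSpace.subspace class_ring (range (codeword es)) (module_vec TYPE('f :: field) (length es))"
proof (intro subspace.intro submodule.intro vec_vs vec_module)
  show "range (codeword es) \<subseteq> carrier (module_vec TYPE('f) (length es))"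
    by (auto simp: module_vec_simps)
  show "v \<oplus>\<^bsub>module_vec TYPE('f) (length es)\<^esub> w \<in> range (codeword es)"
    if "v \<in> range (codeword es)" "w \<in> range (codeword es)" for v w
    using that by (auto simp: module_vec_simps codeword_add[symmetric])
  show "\<zero>\<^bsub>module_vec TYPE('f) (length es)\<^esub> \<in> range (codeword es)"
    by (auto simp: module_vec_simps codeword_zero[symmetric])
  show "a \<odot>\<^bsub>module_vec TYPE('f) (length es)\<^esub> v \<in> range (codeword es)"
    if "v \<in> range (codeword es)" for a v
    using that by (auto simp: module_vec_simps codeword_smult[symmetric])
qed

text \<open>Reduces a dimension computation to exhibiting a linear parametrisation by F^k;
  \<open>C\<close> is made a space of its own by replacing the carrier.\<close>

lemma dim_eq_of_linear_bij:
  fixes T :: "'f :: field vec \<Rightarrow> 'f vec"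
  assumes C: "VectorSpace.subspace class_ring C (module_vec TYPE('f) N)"
    and bij: "bij_betw T (carrier_vec k) C"
    and add: "\<And>x y. \<lbrakk>x \<in> carrier_vec k; y \<in> carrier_vec k\<rbrakk> \<Longrightarrow> T (x + y) = T x + T y"
    and smult: "\<And>a x. x \<in> carrier_vec k \<Longrightarrow> T (a \<cdot>\<^sub>v x) = a \<cdot>\<^sub>v T x"
  shows "vectorspace.dim class_ring ((module_vec TYPE('f) N)\<lparr>carrier := C\<rparr>) = k"
proof -
  let ?W = "(module_vec TYPE('f) N)\<lparr>carrier := C\<rparr>"
  interpret U: vec_space "TYPE('f)" k .
  have W: "vectorspace class_ring ?W"
    by (rule vectorspace.subspace_is_vs[OF vec_vs C])
  have "linear_map class_ring (module_vec TYPE('f) k) ?W T"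
    unfolding linear_map_def mod_hom_def mod_hom_axioms_def LinearCombinations.module_hom_def
    using W vectorspace.axioms(1)[OF W] vec_vs[of k] vec_module[of k] bij add smult
    by (auto simp: module_vec_simps bij_betw_def)
  then have "vectorspace.dim class_ring (module_vec TYPE('f) k) = vectorspace.dim class_ring ?W"
    by (rule linear_map.dim_eq) (use U.fin_dim bij in \<open>auto simp: bij_betw_def module_vec_simps\<close>)
  then show ?thesis
    using U.dim_is_n by simp
qed

section \<open>Dimension and minimum distance from an edge relation and a cut bound\<close>

context simple_graph
begin

text \<open>Since \<open>d\<close> is positive, \<open>cut_ge\<close> also contains connectedness:
  no proper nonempty vertex set has an empty cut.\<close>

context
  fixes \<epsilon> :: "'v \<Rightarrow> 'q :: prime_card mod_ring" and d :: nat
  assumes eps_nonzero: "\<And>v. v \<in> V \<Longrightarrow> \<epsilon> v \<noteq> 0"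
    and eps_edge: "\<And>x y. {x, y} \<in> E \<Longrightarrow> \<epsilon> x + \<epsilon> y = 0"
    and d_pos: "0 < d"
    and cut_ge: "\<And>S. \<lbrakk>S \<subseteq> V; S \<noteq> {}; S \<noteq> V\<rbrakk> \<Longrightarrow> d \<le> card (cut S)"
begin

text \<open>From \<epsilon> y = - \<epsilon> x, the sum c x + c y equals \<epsilon> x times the
  difference of the two quotients.\<close>

lemma edge_sum_nonzero_iff:
  assumes "{x, y} \<in> E"
  shows "(\<Sum>v\<in>{x, y}. c v) \<noteq> 0 \<longleftrightarrow> c x / \<epsilon> x \<noteq> c y / \<epsilon> y"
proof -
  have V: "x \<in> V" "y \<in> V"
    using edge_subset[OF assms] by auto
  have y: "\<epsilon> y = - \<epsilon> x"
    using eps_edge[OF assms] by (simp add: eq_neg_iff_add_eq_0 add.commute)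
  have "(\<Sum>v\<in>{x, y}. c v) = c x + c y"
    using edge_distinct[OF assms] by simp
  then show ?thesis
    using eps_nonzero[OF V(1)] by (simp add: y field_simps eq_neg_iff_add_eq_0)
qed

lemma cut_subset_support:
  "cut {v \<in> V. c v / \<epsilon> v = a} \<subseteq> {e \<in> E. (\<Sum>v\<in>e. c v) \<noteq> 0}"
proof
  fix e assume e: "e \<in> cut {v \<in> V. c v / \<epsilon> v = a}"
  then have eE: "e \<in> E"
    by (simp add: cut_def)
  then obtain x y where xy: "e = {x, y}"
    using edge_ends by blast
  then have "x \<in> V" "y \<in> V"
    using edge_subset[OF eE] by auto
  then have "c x / \<epsilon> x \<noteq> c y / \<epsilon> y"
    using e unfolding xy cut_def by auto
  then have "(\<Sum>v\<in>e. c v) \<noteq> 0"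
    using edge_sum_nonzero_iff[of x y c] eE unfolding xy by blast
  with eE show "e \<in> {e \<in> E. (\<Sum>v\<in>e. c v) \<noteq> 0}"
    by simp
qed

text \<open>The level set of c / \<epsilon> through \<open>w\<close> is nonempty. Either it is all
  of \<open>V\<close>, or its cut has at least \<open>d\<close> edges and lies in the
  support.\<close>

lemma support_ge_or_proportional:
  assumes "w \<in> V"
  shows "d \<le> card {e \<in> E. (\<Sum>v\<in>e. c v) \<noteq> 0} \<or> (\<forall>v\<in>V. c v / \<epsilon> v = c w / \<epsilon> w)"
proof (rule disjCI)
  let ?S = "{v \<in> V. c v / \<epsilon> v = c w / \<epsilon> w}"
  assume "\<not> (\<forall>v\<in>V. c v / \<epsilon> v = c w / \<epsilon> w)"
  then have "d \<le> card (cut ?S)"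
    using assms by (intro cut_ge) auto
  also have "\<dots> \<le> card {e \<in> E. (\<Sum>v\<in>e. c v) \<noteq> 0}"
    using finite_edges by (intro card_mono cut_subset_support) simp
  finally show "d \<le> card {e \<in> E. (\<Sum>v\<in>e. c v) \<noteq> 0}" .
qed

lemma zero_edge_sums_imp_proportional:
  assumes "\<forall>e\<in>E. (\<Sum>v\<in>e. c v) = 0" "v \<in> V" "w \<in> V"
  shows "c v / \<epsilon> v = c w / \<epsilon> w"
proof -
  have "{e \<in> E. (\<Sum>v\<in>e. c v) \<noteq> 0} = {}"
    using assms(1) by blast
  then show ?thesis
    using support_ge_or_proportional[OF assms(3), of c] d_pos assms(2) by (metis card.empty leD)
qed

lemma proportional_imp_zero_edge_sums:
  assumes "\<forall>v\<in>V. c v / \<epsilon> v = a" "e \<in> E"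
  shows "(\<Sum>v\<in>e. c v) = 0"
proof -
  obtain x y where "x \<in> V" "y \<in> V" and e: "e = {x, y}"
    using edge_ends[OF assms(2)] by blast
  then have "c x / \<epsilon> x = c y / \<epsilon> y"
    using assms(1) by simp
  then show ?thesis
    using edge_sum_nonzero_iff[of x y c] assms(2) unfolding e by blast
qed

text \<open>Coefficient functions giving the same codeword differ on \<open>V\<close> by a multiple
  of \<epsilon>, and \<epsilon> does not vanish at \<open>w\<close>. So each codeword has exactly
  one coefficient function on \<open>V\<close> that is 0 at \<open>w\<close>, and the other
  \<open>card V - 1\<close> values are free coordinates.\<close>

lemma dim_codewords:
  assumes es: "set es = E" and w: "w \<in> V"
  shows "vectorspace.dim class_ring
    ((module_vec TYPE('q mod_ring) (length es))\<lparr>carrier := range (codeword es)\<rparr>) = card V - 1"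
proof -
  let ?k = "card V - 1" and ?M = "V - {w}"
  have "card ?M = ?k" "finite ?M"
    using w finite_vertices by simp_all
  then obtain h where h: "bij_betw h {0..<?k} ?M"
    using ex_bij_betw_nat_finite by metis
  define g where "g = inv_into {0..<?k} h"
  have g: "g v < ?k" "h (g v) = v" if "v \<in> ?M" for v
    using bij_betw_inv_into_right[OF h that] bij_betwE[OF bij_betw_inv_into[OF h]] that
    by (auto simp: g_def)
  have hM: "h i \<in> ?M" and gh: "g (h i) = i" if "i < ?k" for i
    using bij_betwE[OF h] bij_betw_inv_into_left[OF h] that by (auto simp: g_def)
  \<comment> \<open>Coordinates are spread over the vertices other than \<open>w\<close>; the
    default 0 at \<open>w\<close> is the normalisation.\<close>
  define ext where "ext x v = (if v \<in> ?M then x $ g v else 0)" for x :: "'q mod_ring vec" and v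
  define T where "T x = codeword es (ext x)" for x
  have "inj_on T (carrier_vec ?k)"
  proof (rule inj_onI)
    fix x y :: "'q mod_ring vec"
    assume xy: "x \<in> carrier_vec ?k" "y \<in> carrier_vec ?k" "T x = T y"
    let ?c = "\<lambda>v. ext x v - ext y v"
    have "\<forall>e\<in>E. (\<Sum>v\<in>e. ?c v) = 0"
      using xy(3) by (simp add: T_def codeword_eq_iff es sum_subtractf)
    \<comment> \<open>The difference is a multiple of \<epsilon> that vanishes at \<open>w\<close>,
      hence zero on \<open>V\<close>.\<close>
    from zero_edge_sums_imp_proportional[OF this _ w]
    have "?c v / \<epsilon> v = ?c w / \<epsilon> w" if "v \<in> V" for v
      using that .
    then have "?c v / \<epsilon> v = 0" if "v \<in> V" for v
      using that by (simp add: ext_def)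
    then have c0: "?c v = 0" if "v \<in> V" for v
      using that eps_nonzero by fastforce
    show "x = y"
    proof (rule eq_vecI)
      fix i assume "i < dim_vec y"
      then have i: "i < ?k"
        using xy(2) by simp
      then show "x $ i = y $ i"
        using c0[of "h i"] hM[OF i] gh[OF i] by (simp add: ext_def)
    qed (use xy in simp)
  qed
  moreover have "T ` carrier_vec ?k = range (codeword es)"
  proof (intro equalityI subsetI)
    fix u :: "'q mod_ring vec"
    assume "u \<in> range (codeword es)"
    then obtain c where u: "u = codeword es c"
      by blast
    \<comment> \<open>Subtracting a multiple of \<open>\<epsilon>\<close> does not change the codeword and makes the coefficient at
      \<open>w\<close> vanish.\<close>
    define t where "t = c w / \<epsilon> w"
    define b where "b v = c v - t * \<epsilon> v" for v
    have bw: "b w = 0"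
      using eps_nonzero[OF w] by (simp add: b_def t_def)
    have "(\<Sum>v\<in>e. t * \<epsilon> v) = 0" if "e \<in> E" for e
      using eps_nonzero by (intro proportional_imp_zero_edge_sums[of _ t] that) simp
    then have ub: "u = codeword es b"
      by (simp add: u codeword_eq_iff es b_def sum_subtractf)
    define x where "x = vec ?k (\<lambda>i. b (h i))"
    have "ext x v = b v" if "v \<in> V" for v
      using that bw g[of v] by (auto simp: ext_def x_def)
    then have "T x = u"
      unfolding T_def ub codeword_eq_iff es
      by (intro ballI sum.cong refl) (use edge_subset in blast)
    then show "u \<in> T ` carrier_vec ?k"
      by (intro image_eqI[of _ _ x]) (simp_all add: x_def)
  qed (auto simp: T_def)
  ultimately have "bij_betw T (carrier_vec ?k) (range (codeword es))"
    by (simp add: bij_betw_def)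
  then show ?thesis
  proof (rule dim_eq_of_linear_bij[OF subspace_codewords])
    fix x y :: "'q mod_ring vec" and a
    assume x: "x \<in> carrier_vec ?k"
    have "ext (a \<cdot>\<^sub>v x) v = a * ext x v" for v
      using g[of v] x by (auto simp: ext_def)
    then have "ext (a \<cdot>\<^sub>v x) = (\<lambda>v. a * ext x v)"
      by blast
    then show "T (a \<cdot>\<^sub>v x) = a \<cdot>\<^sub>v T x"
      by (simp add: T_def codeword_smult)
    assume y: "y \<in> carrier_vec ?k"
    have "ext (x + y) v = ext x v + ext y v" for v
      using g[of v] x y by (auto simp: ext_def)
    then have "ext (x + y) = (\<lambda>v. ext x v + ext y v)"
      by blast
    then show "T (x + y) = T x + T y"
      by (simp add: T_def codeword_add)
  qed
qed

text \<open>The lower bound comes from the cuts; the row of a vertex of degree \<open>d\<close>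
  attains it.\<close>

lemma linear_code_incidence_matrix:
  assumes H: "is_incidence_matrix H (V, E)"
    and w: "w \<in> V" "card (nbrs w) = d"
  shows "linear_code (card E) (card V - 1) d CARD('q) (code_of H :: 'q mod_ring vec set)"
proof -
  obtain vs es where vs: "distinct vs" "set vs = V" and es: "distinct es" "set es = E"
    and "H = mat (length vs) (length es) (\<lambda>(i, j). if vs ! i \<in> es ! j then 1 else 0)"
    using H unfolding is_incidence_matrix_def by auto
  then have C: "(code_of H :: 'q mod_ring vec set) = range (codeword es)"
    using code_of_incidence_matrix[of vs es] edge_subset by simp
  have len: "card E = length es"
    using es distinct_card by fastforce
  have weight: "hamming_weight (codeword es c) = card {e \<in> E. (\<Sum>v\<in>e. c v) \<noteq> 0}"
    for c :: "'v \<Rightarrow> 'q mod_ring"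
    using hamming_weight_codeword[OF es(1)] es(2) by simp
  have zero: "codeword es c = 0\<^sub>v (length es) \<longleftrightarrow> (\<forall>e\<in>E. (\<Sum>v\<in>e. c v) = 0)"
    for c :: "'v \<Rightarrow> 'q mod_ring"
    by (simp add: codeword_zero[symmetric] codeword_eq_iff es(2))
  have ge: "d \<le> hamming_weight (codeword es c)" if "codeword es c \<noteq> 0\<^sub>v (length es)"
    for c :: "'v \<Rightarrow> 'q mod_ring"
    using that support_ge_or_proportional[OF w(1), of c] proportional_imp_zero_edge_sums[of c]
    unfolding zero weight by blast
  \<comment> \<open>The indicator of \<open>w\<close>, whose codeword is the row of
    \<open>w\<close>; its support is the set of edges at \<open>w\<close>.\<close>
  let ?b = "\<lambda>v. if v = w then 1 else 0 :: 'q mod_ring"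
  have "(\<Sum>v\<in>e. ?b v) \<noteq> 0 \<longleftrightarrow> w \<in> e" if "e \<in> E" for e
    using finite_subset[OF edge_subset[OF that] finite_vertices] by simp
  then have supp: "{e \<in> E. (\<Sum>v\<in>e. ?b v) \<noteq> 0} = {e \<in> E. w \<in> e}"
    by blast
  then have eq: "hamming_weight (codeword es ?b) = d"
    by (simp only: weight card_incident w(2))
  have "codeword es ?b \<noteq> 0\<^sub>v (length es)"
  proof
    assume "codeword es ?b = 0\<^sub>v (length es)"
    then have "{e \<in> E. (\<Sum>v\<in>e. ?b v) \<noteq> 0} = {}"
      unfolding zero by blast
    then have "hamming_weight (codeword es ?b) = 0"
      by (simp only: weight card.empty)
    then show False
      using eq d_pos by simp
  qed
  then show ?thesis
    unfolding linear_code_def C len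
    using dim_codewords[OF es(2) w(1)] subspace_codewords eq ge by fastforce
qed

end

end

section \<open>The unit graph of the integers modulo $n$\<close>

lemma residue_coset_bij:
  fixes x n :: int
  assumes "n > 0"
  shows "bij_betw (\<lambda>y. (x + y) mod n) {0..n - 1} {0..n - 1}"
  unfolding bij_betw_def
proof
  show inj: "inj_on (\<lambda>y. (x + y) mod n) {0..n - 1}"
  proof (rule inj_onI)
    fix y z assume yz: "y \<in> {0..n - 1}" "z \<in> {0..n - 1}" "(x + y) mod n = (x + z) mod n"
    then have "[y = z] (mod n)"
      using cong_add_lcancel by (metis cong_def)
    then show "y = z"
      using yz by (simp add: cong_def)
  qed
  show "(\<lambda>y. (x + y) mod n) ` {0..n - 1} = {0..n - 1}"
    using assms by (intro endo_inj_surj inj) auto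
qed

text \<open>Translation by \<open>x\<close> permutes the residues and carries this set onto the
  units, so the count does not depend on \<open>x\<close>.\<close>

lemma card_coprime_shift:
  assumes "n > 1"
  shows "card {y \<in> {0..int n - 1}. coprime (x + y) (int n)} = totient n"
proof -
  define R where "R = residue_ring (int n)"
  interpret residues "int n" R
    using assms by unfold_locales (simp_all add: R_def)
  have bij: "bij_betw (\<lambda>y. (x + y) mod int n) {0..int n - 1} {0..int n - 1}"
    using assms by (intro residue_coset_bij) simp
  have Un: "Units R = {z \<in> {0..int n - 1}. coprime z (int n)}"
  proof -
    have "z \<noteq> 0" if "coprime z (int n)" for z
      using that assms by auto
    then show ?thesis
      unfolding res_units_eq by force
  qed
  have "bij_betw (\<lambda>y. (x + y) mod int n) {y \<in> {0..int n - 1}. coprime (x + y) (int n)} (Units R)"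
    unfolding bij_betw_def
  proof
    show "inj_on (\<lambda>y. (x + y) mod int n) {y \<in> {0..int n - 1}. coprime (x + y) (int n)}"
      using bij by (auto simp: bij_betw_def intro: inj_on_subset)
    show "(\<lambda>y. (x + y) mod int n) ` {y \<in> {0..int n - 1}. coprime (x + y) (int n)} = Units R"
    proof safe
      fix z assume "z \<in> Units R"
      then have z: "z \<in> {0..int n - 1}" "coprime z (int n)"
        by (simp_all add: Un)
      then obtain y where "y \<in> {0..int n - 1}" "z = (x + y) mod int n"
        using bij_betw_imp_surj_on[OF bij] by blast
      with z(2) show "z \<in> (\<lambda>y. (x + y) mod int n) ` {y \<in> {0..int n - 1}. coprime (x + y) (int n)}"
        by simp
    qed (use assms in \<open>simp add: Un\<close>)
  qed
  then show ?thesis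
    using totient_eq bij_betw_same_card by fastforce
qed

text \<open>The residues to avoid are -x and -y. If they coincide modulo \<open>p\<close>, 1 - x
  works. If \<open>p\<close> is odd, both 1 - x and 2 - x avoid -x, and being consecutive they
  cannot both be congruent to -y.\<close>

lemma prime_avoid_two_shifts:
  fixes x y p :: int
  assumes p: "prime p" and "odd p \<or> p dvd x - y"
  shows "\<exists>z. \<not> p dvd x + z \<and> \<not> p dvd y + z"
proof (cases "p dvd x - y")
  case True
  have "\<not> p dvd x + (1 - x)"
    using p by auto
  moreover have "\<not> p dvd y + (1 - x)"
  proof
    assume "p dvd y + (1 - x)"
    from dvd_add[OF True this] have "p dvd 1"
      by simp
    then show False
      using p by (metis not_prime_unit)
  qed
  ultimately show ?thesis
    by blast
next
  case False
  then have "odd p"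
    using assms(2) by blast
  then have "\<not> p dvd 2"
    using p primes_dvd_imp_eq[of p 2] by auto
  have "\<not> p dvd 1"
    using p by auto
  show ?thesis
  proof (cases "p dvd y + (1 - x)")
    case False
    then show ?thesis
      using \<open>\<not> p dvd 1\<close> by (intro exI[of _ "1 - x"]) auto
  next
    case True
    have "\<not> p dvd y + (2 - x)"
    proof
      assume "p dvd y + (2 - x)"
      then have "p dvd (y + (2 - x)) - (y + (1 - x))"
        using True by (rule dvd_diff)
      then show False
        using \<open>\<not> p dvd 1\<close> by simp
    qed
    then show ?thesis
      using \<open>\<not> p dvd 2\<close> by (intro exI[of _ "2 - x"]) auto
  qed
qed

text \<open>Shifts chosen for each prime separately are glued by the Chinese remainder theorem.
  Modulo 2 only one residue may be forbidden, hence the parity condition on \<open>x - y\<close>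
  when \<open>n\<close> is even.\<close>

lemma unit_shifts_exist:
  fixes p1 p2 n1 n2 :: nat and x y :: int
  assumes p: "prime p1" "prime p2" "p1 \<noteq> p2"
    and n: "n = p1 ^ n1 * p2 ^ n2"
    and xy: "odd n \<or> even (x - y)" and "n1 \<ge> 1" "n2 \<ge> 1"
  shows "\<exists>z\<in>{0..int n - 1}. coprime (x + z) (int n) \<and> coprime (y + z) (int n)"
proof -
  have avoid: "\<exists>z. \<not> int q dvd x + z \<and> \<not> int q dvd y + z" if q: "prime q" "q dvd n" for q
  proof (rule prime_avoid_two_shifts)
    show "prime (int q)"
      using q by simp
    show "odd (int q) \<or> int q dvd x - y"
    proof (cases "odd q")
      case False
      then have "q = 2"
        using primes_dvd_imp_eq[OF two_is_prime_nat q(1)] by simp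
      then show ?thesis
        using xy q(2) by auto
    qed simp
  qed
  have dvd: "p1 dvd n" "p2 dvd n"
    unfolding n using assms(6,7) by (auto intro: dvd_mult2 dvd_mult dvd_power)
  obtain z1 where z1: "\<not> int p1 dvd x + z1" "\<not> int p1 dvd y + z1"
    using avoid[OF p(1) dvd(1)] by blast
  obtain z2 where z2: "\<not> int p2 dvd x + z2" "\<not> int p2 dvd y + z2"
    using avoid[OF p(2) dvd(2)] by blast
  have "coprime (int p1) (int p2)"
    using p by (simp add: primes_coprime)
  then obtain z where z: "[z = z1] (mod int p1)" "[z = z2] (mod int p2)"
    using binary_chinese_remainder_int by blast
  have n0: "n > 0"
    unfolding n using p by (simp add: prime_gt_0_nat)
  \<comment> \<open>Coprimality to \<open>n\<close> depends only on the residue modulo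
    \<open>n\<close>, so \<open>z\<close> may be reduced into the vertex range.\<close>
  have cop: "coprime (u + z mod int n) (int n)"
    if u: "\<not> int p1 dvd u + z1" "\<not> int p2 dvd u + z2" for u
  proof -
    have "int p1 dvd u + z \<longleftrightarrow> int p1 dvd u + z1" "int p2 dvd u + z \<longleftrightarrow> int p2 dvd u + z2"
      using z by (auto intro!: cong_dvd_iff cong_add)
    with u have "\<not> int p1 dvd u + z" "\<not> int p2 dvd u + z"
      by simp_all
    then have "coprime (u + z) (int n)"
      unfolding n using p
      by (auto intro!: prime_imp_coprime simp: coprime_commute[of "u + z"])
    moreover have "[u + z mod int n = u + z] (mod int n)"
      by (simp add: cong_def mod_simps)
    ultimately show ?thesis
      by (metis cong_imp_coprime cong_sym)
  qed
  have "z mod int n \<in> {0..int n - 1}"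
    using n0 by simp
  then show ?thesis
    using cop z1 z2 by blast
qed

lemma (in residues) res_add_in_Units_iff: "x \<oplus> y \<in> Units R \<longleftrightarrow> coprime (x + y) m"
proof -
  have "(x + y) mod m \<noteq> 0" if "coprime (x + y) m"
    using that m_gt_one by (auto simp: mod_eq_0_iff_dvd)
  then show ?thesis
    unfolding res_units_eq res_add_eq using m_gt_one
    by (auto simp: order_less_le[of 0])
qed

lemma residues_residue_ring: "n > 1 \<Longrightarrow> residues (int n)"
  by unfold_locales simp

text \<open>Trades ring units for coprimality of the unreduced integer sum, which reduction modulo
  \<open>n\<close> does not affect.\<close>

lemma unit_graph_eq:
  assumes "n > 1"
  shows "unit_graph (residue_ring (int n)) = ({0..int n - 1},
    {{x, y} | x y. x \<in> {0..int n - 1} \<and> y \<in> {0..int n - 1} \<and> x \<noteq> y \<and> coprime (x + y) (int n)})"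
  unfolding unit_graph_def residues.res_carrier_eq[OF residues_residue_ring[OF assms]]
    residues.res_add_in_Units_iff[OF residues_residue_ring[OF assms]] ..

section \<open>Degrees and number of edges of the unit graph\<close>

locale residue_unit_graph =
  fixes n :: nat and V :: "int set" and E :: "int set set"
  assumes n_gt_1: "n > 1"
  defines "V \<equiv> {0..int n - 1}"
    and "E \<equiv> {{x, y} | x y. x \<in> {0..int n - 1} \<and> y \<in> {0..int n - 1} \<and> x \<noteq> y \<and> coprime (x + y) (int n)}"
begin

sublocale simple_graph V E
proof
  show "finite V"
    by (simp add: V_def)
  show "\<exists>x\<in>V. \<exists>y\<in>V. x \<noteq> y \<and> e = {x, y}" if "e \<in> E" for e
    using that unfolding V_def E_def by blast
qed

lemma edge_iff: "{x, y} \<in> E \<longleftrightarrow> x \<in> V \<and> y \<in> V \<and> x \<noteq> y \<and> coprime (x + y) (int n)"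
proof
  assume "{x, y} \<in> E"
  then obtain a b where "{x, y} = {a, b}" "a \<in> V" "b \<in> V" "a \<noteq> b" "coprime (a + b) (int n)"
    unfolding V_def E_def by blast
  then show "x \<in> V \<and> y \<in> V \<and> x \<noteq> y \<and> coprime (x + y) (int n)"
    unfolding doubleton_eq_iff using add.commute[of a b] by metis
next
  show "{x, y} \<in> E" if "x \<in> V \<and> y \<in> V \<and> x \<noteq> y \<and> coprime (x + y) (int n)"
    using that unfolding V_def E_def by blast
qed

lemma nbrs_eq: "x \<in> V \<Longrightarrow> nbrs x = {y \<in> V. coprime (x + y) (int n)} - {x}"
  unfolding nbrs_def edge_iff by blast

text \<open>Among the \<open>totient n\<close> residues whose sum with \<open>x\<close> is a unit,
  \<open>x\<close> itself occurs exactly when 2x is a unit, and it is discarded because there are no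
  loops.\<close>

lemma card_nbrs:
  assumes "x \<in> V"
  shows "card (nbrs x) = (if coprime (2 * x) (int n) then totient n - 1 else totient n)"
proof -
  let ?A = "{y \<in> V. coprime (x + y) (int n)}"
  have "card ?A = totient n"
    using card_coprime_shift[OF n_gt_1] by (simp only: V_def)
  moreover have "finite ?A"
    using finite_vertices by simp
  moreover have "x \<in> ?A \<longleftrightarrow> coprime (2 * x) (int n)"
    using assms by (simp only: mult_2 mem_Collect_eq simp_thms)
  ultimately show ?thesis
    by (simp only: nbrs_eq[OF assms] card_Diff_singleton_if)
qed

lemma card_V: "card V = n"
  by (simp add: V_def)

lemma card_edges_even:
  assumes "even n"
  shows "card E = n * totient n div 2"
proof -
  have "(\<Sum>x\<in>V. card (nbrs x)) = (\<Sum>x\<in>V. totient n)"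
    using assms by (intro sum.cong) (auto simp: card_nbrs)
  then have "n * totient n = 2 * card E"
    by (simp add: handshake card_V)
  then show ?thesis
    by simp
qed

lemma card_edges_odd:
  assumes "odd n"
  shows "card E = (n - 1) * totient n div 2"
proof -
  have cU: "card {x \<in> V. coprime x (int n)} = totient n"
    using card_coprime_shift[OF n_gt_1, of 0] by (simp only: V_def add_0)
  \<comment> \<open>Ensures that the truncated difference \<open>totient n - 1\<close> plus 1 is
    \<open>totient n\<close> again.\<close>
  have pos: "totient n > 0"
    using n_gt_1 by simp
  \<comment> \<open>For odd \<open>n\<close> exactly the units have the deficient degree; adding 1
    for each of them makes all terms equal.\<close>
  have "2 * card E + totient n = (\<Sum>x\<in>V. card (nbrs x)) + (\<Sum>x\<in>V. if coprime x (int n) then 1 else 0)"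
    using cU finite_vertices by (simp add: handshake sum.inter_filter[symmetric])
  also have "\<dots> = (\<Sum>x\<in>V. totient n)"
    unfolding sum.distrib[symmetric] using pos assms by (intro sum.cong) (auto simp: card_nbrs assms)
  finally have "2 * card E = n * totient n - totient n"
    by (simp add: card_V)
  also have "\<dots> = (n - 1) * totient n"
    by (simp add: diff_mult_distrib)
  finally show ?thesis
    by simp
qed

end

section \<open>Code parameters for odd and for even modulus\<close>

lemma (in residue_unit_graph) common_nbrI:
  assumes xyz: "x \<in> V" "y \<in> V" "z \<in> V" and "coprime (x + z) (int n)" "coprime (y + z) (int n)"
    and "x \<noteq> z" "y \<noteq> z"
  shows "nbrs x \<inter> nbrs y \<noteq> {}"
proof -
  have "z \<in> nbrs x \<inter> nbrs y"
    using assms by (simp add: nbrs_eq)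
  then show ?thesis
    by blast
qed

text \<open>Over the two-element field \<epsilon> = 1 is the edge relation. Vertex 1 has the minimum
  degree, because 2 is coprime to \<open>n\<close>.\<close>

lemma (in residue_unit_graph) code_parameters_odd:
  assumes p: "prime p1" "prime p2" "p1 \<noteq> p2" "n1 \<ge> 1" "n2 \<ge> 1"
    and n: "n = p1 ^ n1 * p2 ^ n2" "odd n"
    and H: "is_incidence_matrix H (V, E)"
  shows "linear_code ((n - 1) * totient n div 2) (n - 1) (totient n - 1) 2
    (code_of H :: bool mod_ring vec set)"
proof -
  have n2: "n > 2"
    using n_gt_1 n(2) by (cases "n = 2") auto
  have one: "1 \<in> V" "card (nbrs 1) = totient n - 1"
    using card_nbrs[of 1] n(2) n2 by (auto simp: V_def)
  have "linear_code (card E) (card V - 1) (totient n - 1) CARD(bool) (code_of H :: bool mod_ring vec set)"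
  proof (rule linear_code_incidence_matrix[where \<epsilon> = "\<lambda>_. 1"])
    have "(1 :: bool mod_ring) + 1 = of_nat CARD(bool)"
      by simp
    then show "(1 :: bool mod_ring) + 1 = 0"
      by (simp only: of_nat_card_eq_0)
    show "0 < totient n - 1"
      using totient_gt_1[OF n2] by simp
    show "totient n - 1 \<le> card (cut S)" if "S \<subseteq> V" "S \<noteq> {}" "S \<noteq> V" for S
    proof (rule min_degree_le_cut[OF _ _ that])
      show "totient n - 1 \<le> card (nbrs x)" if "x \<in> V" for x
        using card_nbrs[OF that] by simp
      fix x y assume xy: "x \<in> V" "y \<in> V" "x \<noteq> y" "y \<notin> nbrs x"
      \<comment> \<open>This keeps the shift \<open>z\<close> found below distinct from
        \<open>x\<close> and \<open>y\<close>: equality with either would make x + y coprime to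
        \<open>n\<close>.\<close>
      then have nc: "\<not> coprime (x + y) (int n)"
        by (simp add: nbrs_eq)
      obtain z where z: "z \<in> V" "coprime (x + z) (int n)" "coprime (y + z) (int n)"
        using unit_shifts_exist[OF p(1-3) n(1) _ p(4,5), of x y] n(2) unfolding V_def by blast
      then have "nbrs x \<inter> nbrs y \<noteq> {}"
        using nc xy by (intro common_nbrI[of x y z]) (auto simp: add.commute)
      then show "nbrs x \<inter> nbrs y \<noteq> {} \<or> (\<forall>z\<in>nbrs x. nbrs z \<inter> nbrs y \<noteq> {})" ..
    qed
  qed (use H one in simp_all)
  then show ?thesis
    using card_edges_odd[OF n(2)] by (simp add: card_V)
qed

text \<open>Edges join even to odd residues, so the sign by parity is the edge relation, and the
  graph is regular of degree \<open>totient n\<close> since 2x is never a unit.\<close>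

lemma (in residue_unit_graph) code_parameters_even:
  assumes p: "prime p1" "prime p2" "p1 \<noteq> p2" "n1 \<ge> 1" "n2 \<ge> 1"
    and n: "n = p1 ^ n1 * p2 ^ n2" "even n"
    and H: "is_incidence_matrix H (V, E)"
  shows "linear_code (n * totient n div 2) (n - 1) (totient n) CARD('q :: prime_card)
    (code_of H :: 'q mod_ring vec set)"
proof -
  have deg: "card (nbrs x) = totient n" if "x \<in> V" for x
    using card_nbrs[OF that] n(2) by simp
  have odd_sum: "odd (x + y)" if "coprime (x + y) (int n)" for x y :: int
    using that n(2) coprime_common_divisor[of "x + y" "int n" 2] by auto
  have common: "nbrs x \<inter> nbrs y \<noteq> {}" if xy: "x \<in> V" "y \<in> V" "even (x - y)" for x y
  proof -
    obtain z where z: "z \<in> V" "coprime (x + z) (int n)" "coprime (y + z) (int n)"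
      using unit_shifts_exist[OF p(1-3) n(1) _ p(4,5), of x y] xy(3) unfolding V_def by blast
    then show ?thesis
      using odd_sum[OF z(2)] odd_sum[OF z(3)] xy by (intro common_nbrI[of x y z]) auto
  qed
  have "linear_code (card E) (card V - 1) (totient n) CARD('q) (code_of H :: 'q mod_ring vec set)"
  proof (rule linear_code_incidence_matrix[where \<epsilon> = "\<lambda>v. if even v then 1 else - 1"])
    show "(if even x then 1 else - 1) + (if even y then 1 else - 1) = (0 :: 'q mod_ring)"
      if "{x, y} \<in> E" for x y
      using odd_sum[of x y] that by (auto simp: edge_iff)
    show "0 < totient n"
      using n_gt_1 by simp
    show "totient n \<le> card (cut S)" if "S \<subseteq> V" "S \<noteq> {}" "S \<noteq> V" for S
    proof (rule min_degree_le_cut[OF _ _ that])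
      show "totient n \<le> card (nbrs x)" if "x \<in> V" for x
        using deg[OF that] by simp
      fix x y assume xy: "x \<in> V" "y \<in> V"
      show "nbrs x \<inter> nbrs y \<noteq> {} \<or> (\<forall>z\<in>nbrs x. nbrs z \<inter> nbrs y \<noteq> {})"
      proof (cases "even (x - y)")
        case True
        then show ?thesis
          using common[OF xy] by blast
      next
        case False
        \<comment> \<open>A neighbour \<open>z\<close> of \<open>x\<close> has the parity of
          \<open>y\<close>, so \<open>z\<close> and \<open>y\<close> have a common
          neighbour.\<close>
        have "nbrs z \<inter> nbrs y \<noteq> {}" if "z \<in> nbrs x" for z
        proof (rule common)
          have "coprime (x + z) (int n)"
            using that xy(1) by (simp add: nbrs_eq)
          then show "even (z - y)"
            using odd_sum[of x z] False by simp
          show "z \<in> V"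
            using that nbrs_subset by blast
        qed (rule xy(2))
        then show ?thesis
          by blast
      qed
    qed
    show "0 \<in> V" "card (nbrs 0) = totient n"
      using n_gt_1 deg[of 0] by (simp_all add: V_def)
  qed (use H in auto)
  then show ?thesis
    using card_edges_even[OF n(2)] by (simp add: card_V)
qed

theorem theorem4p8:
  fixes p1 p2 n1 n2 n :: nat
    and H :: "int mat"
  defines "R \<equiv> residue_ring (int n)"
  assumes "prime p1" and "prime p2" and "p1 \<noteq> p2"
    and "n1 \<ge> 1" and "n2 \<ge> 1"
    and "n = p1 ^ n1 * p2 ^ n2"
    and "is_incidence_matrix H (unit_graph R)"
  shows "(\<one>\<^bsub>R\<^esub> \<oplus>\<^bsub>R\<^esub> \<one>\<^bsub>R\<^esub> \<in> Units R \<longrightarrow>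
            linear_code ((n - 1) * totient n div 2) (n - 1) (totient n - 1) 2
              (code_of H :: bool mod_ring vec set))
       \<and> (\<one>\<^bsub>R\<^esub> \<oplus>\<^bsub>R\<^esub> \<one>\<^bsub>R\<^esub> \<notin> Units R \<longrightarrow>
            odd CARD('q :: prime_card) \<longrightarrow>
            linear_code (n * totient n div 2) (n - 1) (totient n) (CARD('q))
              (code_of H :: 'q mod_ring vec set))"
proof (rule conjI; intro impI)
  have pow: "p1 ^ n1 \<ge> 2" "p2 ^ n2 \<ge> 2"
    using self_le_power[of p1 n1] self_le_power[of p2 n2] prime_ge_2_nat[OF assms(2)]
      prime_ge_2_nat[OF assms(3)] assms(5,6) by linarith+
  then have n: "n > 1"
    using mult_le_mono[OF pow] unfolding assms(7) by linarith
  interpret R: residues "int n" R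
    unfolding R_def using n by unfold_locales simp
  define V where "V = {0..int n - 1}"
  define E where "E = {{x, y} | x y. x \<in> {0..int n - 1} \<and> y \<in> {0..int n - 1} \<and> x \<noteq> y \<and>
    coprime (x + y) (int n)}"
  have G: "residue_unit_graph n"
    using n by unfold_locales
  have H: "is_incidence_matrix H (V, E)"
    using assms(8) unit_graph_eq[OF n] by (simp add: R_def V_def E_def)
  \<comment> \<open>The ring element 1 + 1 is a unit iff the integer 2 is coprime to
    \<open>n\<close>, which makes the two cases a split by the parity of \<open>n\<close>.\<close>
  have two: "\<one>\<^bsub>R\<^esub> \<oplus>\<^bsub>R\<^esub> \<one>\<^bsub>R\<^esub> \<in> Units R \<longleftrightarrow> odd n"
    by (simp add: R.res_add_in_Units_iff R.res_one_eq)
  show "linear_code ((n - 1) * totient n div 2) (n - 1) (totient n - 1) 2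
      (code_of H :: bool mod_ring vec set)"
    if "\<one>\<^bsub>R\<^esub> \<oplus>\<^bsub>R\<^esub> \<one>\<^bsub>R\<^esub> \<in> Units R"
    using residue_unit_graph.code_parameters_odd[OF G assms(2-7)] that two H
    unfolding V_def E_def by blast
  show "linear_code (n * totient n div 2) (n - 1) (totient n) CARD('q)
      (code_of H :: 'q mod_ring vec set)"
    if "\<one>\<^bsub>R\<^esub> \<oplus>\<^bsub>R\<^esub> \<one>\<^bsub>R\<^esub> \<notin> Units R"
    using residue_unit_graph.code_parameters_even[OF G assms(2-7)] that two H
    unfolding V_def E_def by blast
qed

end
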